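(* Let $\lambda$ be the unique real root of $\lambda^3-\lambda^2-\lambda-1=0$. For every $x\in[0,1/2]$ the function $F$ satisfies $$F(1-x)=1-\frac{F(x)}{\lambda}.$$
   Context: Continued fraction with minimal remainders: every real $x$ has a unique representation $$x=\left[a_0;\frac{\varepsilon_1}{a_1},\ldots,\frac{\varepsilon_l}{a_l},\ldots\right]=a_0+\cfrac{\varepsilon_1}{a_1+\cfrac{\varepsilon_2}{a_2+\ldots+\cfrac{\varepsilon_l}{a_l+\ldots}}},$$ finite if $x$ is rational and infinite if $x$ is irrational, where $a_0\in\mathbb{Z}$, $\varepsilon_j=\pm1$, $a_j\in\mathbb{Z}$, $a_j\geqslant 2$ for $j\geqslant1$, and $a_j+\varepsilon_{j+1}\geqslant2$ for $j\geqslant 1$ whenever $\varepsilon_{j+1}$ is present (equivalently, $a_j=2$ implies $\varepsilon_{j+1}=1$); for rational $x$, if the last partial quotient is $a_s=2$ with $s\geqslant1$, then $\varepsilon_s=1$. (It arises from the division $a=bq+r$, $-b/2<r\leqslant b/2$.) The numbers $a_i$ (including $a_0$) are the partial quotients. For rational $x$, $S(x)$ is the sum $a_0+a_1+\ldots+a_l$ of the partial quotients of this representation. Put $\mathcal{Z}_n=\{x\in\mathbb{Q}\cap[0,1]:S(x)\leqslant n+1\}$ (a finite set). The limit distribution function is $$F(x)=\lim_{n\to\infty}\frac{\#\{\xi\in\mathcal{Z}_n:\xi\leqslant x\}}{\#\mathcal{Z}_n},\qquad x\in[0,1].$$ *)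

theory Defs
  imports Complex_Main
begin

text \<open>
  A finite continued fraction with minimal remainders is given by its integer part \<open>a0\<close> and
  the list of pairs \<open>(eps_j, a_j)\<close> for \<open>j = 1, ..., s\<close>; the pair with index \<open>j\<close> is the list
  element at position \<open>j - 1\<close>. Sums of partial quotients are only taken for rationals, so infinite
  expansions are not needed.
\<close>

fun mr_value :: "int \<Rightarrow> (int \<times> int) list \<Rightarrow> real" where
  "mr_value a [] = of_int a"
| "mr_value a ((e, b) # cs) = of_int a + of_int e / mr_value b cs"

text \<open>
  The integer part is unconstrained, and so is \<open>a0 + eps_1\<close>. The last condition makes the
  remainder \<open>1/2\<close> positive: \<open>1/2 = 0 + 1/2\<close> is admitted and \<open>1/2 = 1 - 1/2\<close> is not.
\<close>

definition mr_digits :: "(int \<times> int) list \<Rightarrow> bool" where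
  "mr_digits cs \<longleftrightarrow>
     (\<forall>j<length cs. fst (cs ! j) \<in> {1, -1} \<and> snd (cs ! j) \<ge> 2) \<and>
     (\<forall>j. Suc j < length cs \<longrightarrow> snd (cs ! j) + fst (cs ! Suc j) \<ge> 2) \<and>
     (cs \<noteq> [] \<and> snd (last cs) = 2 \<longrightarrow> fst (last cs) = 1)"

definition mr_expansion :: "real \<Rightarrow> int \<times> (int \<times> int) list" where
  "mr_expansion x = (THE p. mr_digits (snd p) \<and> x = mr_value (fst p) (snd p))"

definition mr_sum :: "real \<Rightarrow> int" where
  "mr_sum x = fst (mr_expansion x) + sum_list (map snd (snd (mr_expansion x)))"

definition mr_Z :: "nat \<Rightarrow> real set" where
  "mr_Z n = {x \<in> \<rat> \<inter> {0..1}. mr_sum x \<le> int n + 1}"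

definition mr_F :: "real \<Rightarrow> real" where
  "mr_F x = lim (\<lambda>n. real (card {\<xi> \<in> mr_Z n. \<xi> \<le> x}) / real (card (mr_Z n)))"

text \<open>
  The following facts show that \<open>mr_sum\<close> and the cardinalities are meaningful: rational
  numbers have exactly one expansion, and the sets \<open>mr_Z n\<close> are finite.
\<close>

lemma mr_digits_Nil [simp]: "mr_digits []"
  by (simp add: mr_digits_def)

lemma mr_digits_Cons:
  "mr_digits ((e, a) # cs) \<longleftrightarrow>
     e \<in> {1, -1} \<and> a \<ge> 2 \<and> mr_digits cs \<and> (cs \<noteq> [] \<longrightarrow> a + fst (hd cs) \<ge> 2) \<and>
     (cs = [] \<and> a = 2 \<longrightarrow> e = 1)"
  by (cases cs) (auto simp: mr_digits_def All_less_Suc2)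

lemma mr_value_bounds:
  assumes "mr_digits cs"
  shows "mr_value a cs - of_int a > -1/2 \<and> mr_value a cs - of_int a \<le> 1/2"
    and "mr_digits ((e, a) # cs) \<Longrightarrow> mr_value a cs \<ge> 2 \<and> (mr_value a cs = 2 \<longrightarrow> e = 1)"
  using assms
proof (induction cs arbitrary: a e)
  case Nil
  { case 1 show ?case by simp }
  { case 2 then show ?case by (auto simp: mr_digits_Cons) }
next
  case (Cons p cs)
  obtain f b where p: "p = (f, b)" by (cases p)
  {
    fix a
    assume d: "mr_digits (p # cs)"
    then have dc: "mr_digits cs" by (simp add: p mr_digits_Cons)
    have v: "mr_value b cs \<ge> 2" "mr_value b cs = 2 \<longrightarrow> f = 1"
      using Cons.IH(2)[of f b] d dc by (auto simp: p)
    define y where "y = 1 / mr_value b cs"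
    have i: "0 < y" "y \<le> 1/2" "mr_value b cs \<noteq> 2 \<Longrightarrow> y < 1/2"
      unfolding y_def
      using v(1) by (auto simp: field_simps)
    have f: "f = 1 \<or> f = -1" using d by (auto simp: p mr_digits_Cons)
    have "mr_value a (p # cs) - of_int a = (if f = 1 then y else - y)"
      using f by (auto simp: p y_def)
    then have "mr_value a (p # cs) - of_int a > -1/2 \<and> mr_value a (p # cs) - of_int a \<le> 1/2
         \<and> (f = 1 \<longrightarrow> mr_value a (p # cs) > of_int a)"
      using i v f by (cases "mr_value b cs = 2"; cases "f = 1"; simp; linarith)
  } note bnd = this
  { case 1 then show ?case using bnd by blast }
  { case 2
    then have d: "mr_digits (p # cs)" and a: "a \<ge> 2" "a + f \<ge> 2" and f: "f = 1 \<or> f = -1"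
      by (auto simp: p mr_digits_Cons)
    show ?case
    proof (cases "a = 2")
      case True
      then have "f = 1" using a f by auto
      then show ?thesis using bnd[OF d, of a] True by auto
    next
      case False
      then have "real_of_int a \<ge> 3" using a by linarith
      then show ?thesis using bnd[OF d, of a] by auto
    qed }
qed

lemma mr_digits_ConsD:
  assumes "mr_digits ((e, a) # cs)"
  shows "mr_digits cs" "e = 1 \<or> e = -1" "mr_value a cs \<ge> 2" "mr_value a cs = 2 \<Longrightarrow> e = 1"
proof -
  show d: "mr_digits cs" and "e = 1 \<or> e = -1"
    using assms by (simp_all add: mr_digits_Cons)
  show "mr_value a cs \<ge> 2" "mr_value a cs = 2 \<Longrightarrow> e = 1"
    using mr_value_bounds(2)[OF d assms] by blast+
qed

lemma mr_value_inj:
  assumes "mr_digits cs" "mr_digits ds" "mr_value a cs = mr_value b ds"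
  shows "a = b \<and> cs = ds"
  using assms
proof (induction cs arbitrary: ds a b)
  case Nil
  have ab: "a = b"
    using mr_value_bounds(1)[OF Nil(1), of a] mr_value_bounds(1)[OF Nil(2), of b] Nil(3) by linarith
  show ?case
  proof (cases ds)
    case (Cons q ds')
    obtain f d where q: "q = (f, d)" by (cases q)
    have "mr_digits ((f, d) # ds')" using Nil(2) by (simp add: Cons q)
    note D = mr_digits_ConsD[OF this]
    have "of_int f / mr_value d ds' = 0" using Nil(3) ab by (simp add: Cons q)
    then show ?thesis using D(2,3) by (elim disjE) simp_all
  qed (use ab in auto)
next
  case (Cons p cs)
  obtain e c where p: "p = (e, c)" by (cases p)
  have ab: "a = b"
    using mr_value_bounds(1)[OF Cons.prems(1), of a] mr_value_bounds(1)[OF Cons.prems(2), of b]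
      Cons.prems(3) by linarith
  have "mr_digits ((e, c) # cs)" using Cons.prems(1) by (simp add: p)
  note v = mr_digits_ConsD[OF this]
  show ?case
  proof (cases ds)
    case Nil
    then have "of_int e / mr_value c cs = 0" using Cons.prems(3) ab by (simp add: p)
    then show ?thesis using v(2,3) by (elim disjE) simp_all
  next
    case (Cons q ds')
    obtain f d where q: "q = (f, d)" by (cases q)
    have "mr_digits ((f, d) # ds')" using Cons.prems(2) by (simp add: Cons q)
    note w = mr_digits_ConsD[OF this]
    have eq: "of_int e / mr_value c cs = of_int f / mr_value d ds'"
      using Cons.prems(3) ab by (simp add: Cons p q)
    have pos: "1 / mr_value c cs > 0" "1 / mr_value d ds' > 0"
      using v(3) w(3) by simp_all
    have ef: "e = f" using v(2) w(2) eq pos by (elim disjE) simp_all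
    then have "mr_value c cs = mr_value d ds'" using eq v(2,3) w(3) by (elim disjE) simp_all
    then show ?thesis using Cons.IH[OF v(1) w(1)] ab ef by (simp add: \<open>ds = q # ds'\<close> p q)
  qed
qed

lemma mr_expansion_exists_aux:
  assumes "q > 0"
  shows "\<exists>a cs. mr_digits cs \<and> of_int p / of_nat q = mr_value a cs"
  using assms
proof (induction q arbitrary: p rule: less_induct)
  case (less q)
  define a where "a = \<lceil>of_int p / real q - 1/2\<rceil>"
  define r where "r = p - a * int q"
  have q: "real q > 0" using less.prems by simp
  have pr: "of_int p / real q = of_int a + of_int r / real q"
    using q by (simp add: r_def field_simps)
  have "of_int p / real q - of_int a > - (1/2)" "of_int p / real q - of_int a \<le> 1/2"
    unfolding a_def by linarith+
  then have r: "of_int r / real q > - (1/2)" "of_int r / real q \<le> 1/2" using pr by auto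
  show ?case
  proof (cases "r = 0")
    case True
    then have "of_int p / real q = mr_value a []" using pr by simp
    then show ?thesis using mr_digits_Nil by blast
  next
    case False
    define e where "e = sgn r"
    define m where "m = nat \<bar>r\<bar>"
    have e: "e = 1 \<or> e = -1" using False by (auto simp: e_def sgn_if)
    have m: "m > 0" "real m > 0" using False by (auto simp: m_def)
    have rm: "real_of_int r = of_int e * real m" by (auto simp: e_def m_def sgn_if)
    have mq: "2 * real m \<le> real q" "2 * real m = real q \<longrightarrow> e = 1"
      using r e q rm by (auto simp: field_simps)
    then have "m < q" using m by linarith
    from less.IH[OF this m(1), of "int q"] obtain b cs
      where cs: "mr_digits cs" "real q / real m = mr_value b cs" by auto
    have v: "mr_value b cs \<ge> 2" "mr_value b cs = 2 \<longrightarrow> e = 1"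
      using mq m unfolding cs(2)[symmetric] by (auto simp: field_simps)
    have b2: "b \<ge> 2" using v(1) mr_value_bounds(1)[OF cs(1), of b] by linarith
    have b3: "b + fst (hd cs) \<ge> 2" if ne: "cs \<noteq> []"
    proof (rule ccontr)
      assume neg: "\<not> b + fst (hd cs) \<ge> 2"
      obtain f d ds where ds: "cs = (f, d) # ds" using ne by (metis list.exhaust surj_pair)
      have "mr_digits ((f, d) # ds)" using cs(1) by (simp add: ds)
      note D = mr_digits_ConsD[OF this]
      have "b = 2" "f = -1" using neg b2 D(2) by (auto simp: ds)
      moreover have "1 / mr_value d ds > 0" using D(3) by simp
      ultimately have "mr_value b cs < 2" by (simp add: ds)
      then show False using v(1) by linarith
    qed
    have "mr_digits ((e, b) # cs)" using e b2 b3 cs(1) v(2) by (auto simp: mr_digits_Cons)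
    moreover have "of_int p / real q = mr_value a ((e, b) # cs)"
      unfolding pr rm mr_value.simps cs(2)[symmetric] by simp
    ultimately show ?thesis by blast
  qed
qed

lemma mr_expansion_unique:
  assumes "x \<in> \<rat>"
  shows "\<exists>!p. mr_digits (snd p) \<and> x = mr_value (fst p) (snd p)"
proof -
  obtain p q where "q > 0" "x = of_int p / of_int q"
    using assms by (metis Rats_cases')
  then have "nat q > 0" "x = of_int p / of_nat (nat q)" by auto
  then obtain a cs where "mr_digits cs" "x = mr_value a cs"
    using mr_expansion_exists_aux by metis
  then show ?thesis
    by (intro ex1I[of _ "(a, cs)"]) (use mr_value_inj in \<open>force simp: prod_eq_iff\<close>)+
qed

lemma mr_sum_eq:
  assumes "mr_digits cs"
  shows "mr_sum (mr_value a cs) = a + sum_list (map snd cs)"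
proof -
  have "mr_expansion (mr_value a cs) = (a, cs)"
    unfolding mr_expansion_def
    by (rule the_equality) (use assms mr_value_inj in \<open>force simp: prod_eq_iff\<close>)+
  then show ?thesis by (simp add: mr_sum_def)
qed

lemma mr_digits_sum_list:
  assumes "mr_digits cs"
  shows "int (length cs) \<le> sum_list (map snd cs)"
    and "p \<in> set cs \<Longrightarrow> fst p \<in> {1, -1} \<and> snd p \<in> {0..sum_list (map snd cs)}"
  using assms
proof (induction cs)
  case (Cons q cs)
  { case 1 then show ?case using Cons.IH(1) by (cases q) (auto simp: mr_digits_Cons) }
  { case 2 then show ?case using Cons.IH by (cases q) (force simp: mr_digits_Cons) }
qed auto

lemma finite_mr_Z: "finite (mr_Z n)"
proof -
  define N where "N = int n + 1"
  define L :: "(int \<times> int) list set" where "L = {cs. set cs \<subseteq> {1, -1} \<times> {0..N} \<and> length cs \<le> nat N}"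
  have "mr_Z n \<subseteq> (\<lambda>(a, cs). mr_value a cs) ` ({0..N} \<times> L)"
  proof
    fix x assume x: "x \<in> mr_Z n"
    then obtain a cs where d: "mr_digits cs" and xv: "x = mr_value a cs"
      using mr_expansion_unique[of x] by (auto simp: mr_Z_def)
    have sum: "a + sum_list (map snd cs) \<le> N" and "x \<ge> 0"
      using x mr_sum_eq[OF d, of a] by (auto simp: mr_Z_def N_def xv)
    then have "a \<ge> 0" using mr_value_bounds(1)[OF d, of a] xv by linarith
    then have *: "sum_list (map snd cs) \<le> N" "a \<le> N"
      using sum mr_digits_sum_list(1)[OF d] by linarith+
    then have "length cs \<le> nat N" using mr_digits_sum_list(1)[OF d] by linarith
    moreover have "set cs \<subseteq> {1, -1} \<times> {0..N}"
      using mr_digits_sum_list(2)[OF d] *(1) by fastforce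
    ultimately have "cs \<in> L" by (simp add: L_def)
    then show "x \<in> (\<lambda>(a, cs). mr_value a cs) ` ({0..N} \<times> L)"
      using \<open>a \<ge> 0\<close> *(2) xv by force
  qed
  moreover have "finite L"
    unfolding L_def by (rule finite_lists_length_le) auto
  ultimately show ?thesis by (meson finite_SigmaI finite_atLeastAtMost_int finite_imageI finite_subset)
qed

lemma cubic_root_unique: "\<exists>!l::real. l^3 - l^2 - l - 1 = 0"
proof -
  have ex: "\<exists>l\<ge>1. l \<le> 2 \<and> l^3 - l^2 - l - 1 = (0::real)"
    by (rule IVT'[where f="\<lambda>l::real. l^3 - l^2 - l - 1"]) (auto intro!: continuous_intros)
  have gt: "l > 1" if "l^3 - l^2 - l - 1 = 0" for l :: real
  proof (rule ccontr)
    assume l: "\<not> l > 1"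
    have eq: "(l - 1)^2 * (l + 1) = 2"
      using that by (simp add: power2_eq_square power3_eq_cube algebra_simps)
    then have "l + 1 > 0" by (smt (verit) mult_nonneg_nonpos zero_le_power2)
    moreover have "(l - 1)^2 * (l + 1) = (1 - l) - l\<^sup>2 * (1 - l)"
      by (simp add: power2_eq_square algebra_simps)
    moreover have "l\<^sup>2 * (1 - l) \<ge> 0" using l by (intro mult_nonneg_nonneg) auto
    ultimately show False using eq by linarith
  qed
  have "l = m" if "l^3 - l^2 - l - 1 = 0" "m^3 - m^2 - m - 1 = 0" for l m :: real
  proof (rule ccontr)
    assume "l \<noteq> m"
    have "(l - m) * (l^2 + l*m + m^2 - l - m - 1) = (l^3 - l^2 - l - 1) - (m^3 - m^2 - m - 1)"
      by (simp add: power2_eq_square power3_eq_cube algebra_simps)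
    then have "l^2 + l*m + m^2 - l - m - 1 = 0" using \<open>l \<noteq> m\<close> that by simp
    moreover have "l^2 > l" "m^2 > m" "l * m > 1"
      using gt[OF that(1)] gt[OF that(2)] less_1_mult[of l m]
      by (simp_all add: power2_eq_square)
    ultimately show False by linarith
  qed
  then show ?thesis using ex by blast
qed

end

theory Submission
  imports Defs
begin

text \<open>
  The digit sum \<open>S\<close> satisfies \<open>S(x + k) = S(x) + k\<close>, \<open>S(1/v) = S(v)\<close> for \<open>v \<ge> 2\<close> and
  \<open>S(1 - x) = S(x) + 1\<close> for \<open>0 \<le> x < 1/2\<close>. Let \<open>A\<^sub>n(x)\<close> count the rationals \<open>\<xi> \<in> [0, x]\<close> with
  \<open>S(\<xi>) \<le> n\<close>. The reflection gives \<open>A\<^sub>n(1 - x) = A\<^sub>n(1) - A\<^bsub>n-1\<^esub>(x) + O(1)\<close> on \<open>[0, 1/2]\<close>, so the claim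
  follows once \<open>A\<^sub>n(x) / \<lambda>\<^sup>n\<close> converges for every \<open>x\<close>, with a positive limit at \<open>x = 1\<close>.
  The number of rationals \<open>v \<ge> 2\<close> with \<open>S(v) \<le> n\<close> is eventually a Tribonacci sequence, hence
  asymptotic to a positive multiple of \<open>\<lambda>\<^sup>n\<close>; this settles \<open>x = 1\<close>. For other \<open>x\<close>, inversion and reflection
  write \<open>A\<^sub>n(x) / \<lambda>\<^sup>n\<close> as a convergent sequence minus \<open>\<lambda>\<^bsup>-k\<^esup>\<close> times the (shifted) sequence of
  another point \<open>y\<close>, with \<open>k \<ge> 1\<close>. So the largest asymptotic oscillation over all \<open>x\<close> is at most
  \<open>1/\<lambda>\<close> times itself, and it is bounded, hence zero.
\<close>

section \<open>Digit sums under translation, inversion and reflection\<close>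

lemma rat_mr_valueE:
  assumes "x \<in> \<rat>"
  obtains a cs where "mr_digits cs" "x = mr_value a cs"
  using mr_expansion_unique[OF assms] by auto

lemma mr_value_add_int: "mr_value (a + k) cs = mr_value a cs + of_int k"
  by (cases cs) auto

lemma mr_sum_add_int:
  assumes "x \<in> \<rat>"
  shows "mr_sum (x + of_int k) = mr_sum x + k"
proof -
  obtain a cs where "mr_digits cs" "x = mr_value a cs"
    using rat_mr_valueE[OF assms] .
  then show ?thesis
    using mr_sum_eq[of cs "a + k"] mr_sum_eq[of cs a] by (simp add: mr_value_add_int)
qed

text \<open>The digits of \<open>inverse v\<close> are those of \<open>v\<close> preceded by
  \<open>(1, b)\<close> with integer part 0. This is admissible: \<open>b = 2\<close> followed by
  the sign -1 would force \<open>v < 2\<close>.\<close>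

lemma mr_sum_inverse:
  assumes "v \<in> \<rat>" "v \<ge> 2"
  shows "mr_sum (inverse v) = mr_sum v"
proof -
  obtain b cs where cs: "mr_digits cs" "v = mr_value b cs"
    using rat_mr_valueE[OF assms(1)] .
  have b2: "b \<ge> 2"
    using mr_value_bounds(1)[OF cs(1), of b] assms(2) cs(2) by linarith
  have "b + fst (hd cs) \<ge> 2" if ne: "cs \<noteq> []"
  proof -
    obtain f d ds where ds: "cs = (f, d) # ds" using ne by (metis list.exhaust surj_pair)
    note D = mr_digits_ConsD[OF cs(1)[unfolded ds]]
    have "1 / mr_value d ds > 0" using D(3) by simp
    moreover have "v = of_int b - 1 / mr_value d ds" if "f = -1"
      using that by (simp add: cs(2) ds)
    ultimately have "real_of_int b > 2" if "f = -1"
      using that assms(2) by (smt (verit))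
    then show ?thesis using b2 D(2) by (auto simp: ds)
  qed
  then have "mr_digits ((1, b) # cs)" using b2 cs(1) by (simp add: mr_digits_Cons)
  from mr_sum_eq[OF this, of 0] mr_sum_eq[OF cs(1), of b] show ?thesis
    by (simp add: cs(2) divide_inverse)
qed

text \<open>Integer part 0 becomes 1 and the first sign flips. Only the lone digit 2, that is
  \<open>x = 1/2\<close>, would forbid the flip.\<close>

lemma mr_sum_reflect:
  assumes "x \<in> \<rat>" "0 \<le> x" "x < 1/2"
  shows "mr_sum (1 - x) = mr_sum x + 1"
proof -
  obtain a cs where cs: "mr_digits cs" "x = mr_value a cs"
    using rat_mr_valueE[OF assms(1)] .
  have a: "a = 0"
    using mr_value_bounds(1)[OF cs(1), of a] assms(2,3) cs(2) by linarith
  show ?thesis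
  proof (cases cs)
    case Nil
    then show ?thesis using mr_sum_eq[OF mr_digits_Nil, of 0] mr_sum_eq[OF mr_digits_Nil, of 1] cs(2) a
      by simp
  next
    case (Cons q ds)
    obtain e b where q: "q = (e, b)" by (cases q)
    have d: "mr_digits ((e, b) # ds)" using cs(1) Cons q by simp
    have "\<not> (ds = [] \<and> b = 2)"
      using d assms(3) cs(2) a by (auto simp: Cons q mr_digits_Cons)
    then have "mr_digits ((- e, b) # ds)" using d by (auto simp: mr_digits_Cons)
    from mr_sum_eq[OF this, of 1] mr_sum_eq[OF d, of 0] show ?thesis
      by (simp add: cs(2) a Cons q)
  qed
qed

lemma mr_sum_of_int: "mr_sum (of_int k) = k"
  using mr_sum_eq[OF mr_digits_Nil, of k] by simp

section \<open>Counting rationals of bounded digit sum\<close>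

definition slice :: "real set \<Rightarrow> int \<Rightarrow> real set" where
  "slice X n = {\<xi> \<in> \<rat> \<inter> X. mr_sum \<xi> \<le> n}"

text \<open>The level is an integer, so shifts \<open>n - k\<close> are never truncated.\<close>

definition cnt :: "real set \<Rightarrow> int \<Rightarrow> nat" where
  "cnt X n = card (slice X n)"

lemma slice_image:
  assumes "\<And>\<xi>. \<xi> \<in> X \<Longrightarrow> \<phi> \<xi> \<in> \<rat> \<longleftrightarrow> \<xi> \<in> \<rat>"
    and "\<And>\<xi>. \<xi> \<in> X \<Longrightarrow> \<xi> \<in> \<rat> \<Longrightarrow> mr_sum (\<phi> \<xi>) = mr_sum \<xi> + k"
  shows "slice (\<phi> ` X) n = \<phi> ` slice X (n - k)"
  using assms unfolding slice_def by force

lemma Rats_add_int_iff: "(x::real) + of_int k \<in> \<rat> \<longleftrightarrow> x \<in> \<rat>"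
  by (metis Rats_add Rats_diff Rats_of_int add_diff_cancel_right')

lemma Rats_one_minus_iff: "1 - (x::real) \<in> \<rat> \<longleftrightarrow> x \<in> \<rat>"
  by (metis Rats_1 Rats_diff diff_diff_eq2 add_diff_cancel_left')

lemma Rats_inverse_iff: "inverse (x::real) \<in> \<rat> \<longleftrightarrow> x \<in> \<rat>"
  by (metis Rats_inverse inverse_inverse_eq)

lemma slice_shift: "slice ((\<lambda>x. x + of_int k) ` X) n = (\<lambda>x. x + of_int k) ` slice X (n - k)"
  by (rule slice_image) (simp_all add: Rats_add_int_iff mr_sum_add_int)

lemma slice_inverse:
  assumes "X \<subseteq> {2..}"
  shows "slice (inverse ` X) n = inverse ` slice X n"
  using slice_image[of X inverse 0 n] assms mr_sum_inverse
  by (simp add: Rats_inverse_iff subset_eq)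

lemma slice_reflect:
  assumes "X \<subseteq> {0..<1/2}"
  shows "slice ((\<lambda>x. 1 - x) ` X) n = (\<lambda>x. 1 - x) ` slice X (n - 1)"
  by (rule slice_image) (use assms in \<open>force simp: Rats_one_minus_iff mr_sum_reflect\<close>)+

lemma slice_mono: "X \<subseteq> Y \<Longrightarrow> slice X n \<subseteq> slice Y n"
  by (auto simp: slice_def)

lemma slice_Un: "slice (X \<union> Y) n = slice X n \<union> slice Y n"
  by (auto simp: slice_def)

lemma inverse_image_atLeast_two: "inverse ` {2..} = {0<..1/2::real}"
proof -
  have "x \<in> inverse ` {2..}" if "x \<in> {0<..1/2}" for x :: real
    using that by (intro image_eqI[of _ _ "inverse x"]) (auto simp: field_simps)
  then show ?thesis by (auto simp: field_simps)
qed

text \<open>Finiteness on [0, 1] is carried to [2, \<infinity>) by inversion and to [1, 2] by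
  translation.\<close>

lemma finite_slice:
  assumes "X \<subseteq> {0..}"
  shows "finite (slice X n)"
proof -
  have unit: "finite (slice {0..1} n)" for n
    by (rule finite_subset[OF _ finite_mr_Z[of "nat n"]]) (auto simp: slice_def mr_Z_def)
  have "finite (inverse ` slice {2..} n)"
    unfolding slice_inverse[OF order_refl, symmetric] inverse_image_atLeast_two
    by (rule finite_subset[OF slice_mono unit]) auto
  then have "finite (slice {2..} n)"
    by (rule finite_imageD) (auto intro: inj_onI)
  moreover have "finite (slice {1..2} n)"
    using unit[of "n - 1"] slice_shift[of 1 "{0..1}" n] by simp
  moreover have "slice X n \<subseteq> slice {0..1} n \<union> slice {1..2} n \<union> slice {2..} n"
    using assms by (auto simp: slice_def)
  ultimately show ?thesis using unit by (meson finite_Un finite_subset)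
qed

lemma cnt_Un:
  assumes "Z = X \<union> Y" "X \<inter> Y = {}" "Z \<subseteq> {0..}"
  shows "cnt Z n = cnt X n + cnt Y n"
  unfolding cnt_def assms(1) slice_Un
  by (rule card_Un_disjoint) (use assms finite_slice in \<open>auto simp: slice_def\<close>)

lemma cnt_mono: "X \<subseteq> Y \<Longrightarrow> Y \<subseteq> {0..} \<Longrightarrow> cnt X n \<le> cnt Y n"
  unfolding cnt_def by (rule card_mono[OF finite_slice slice_mono])

lemma cnt_shift: "cnt ((\<lambda>x. x + of_int k) ` X) n = cnt X (n - k)"
  unfolding cnt_def slice_shift by (rule card_image) (auto intro: inj_onI)

lemma cnt_inverse: "X \<subseteq> {2..} \<Longrightarrow> cnt (inverse ` X) n = cnt X n"
  unfolding cnt_def slice_inverse by (rule card_image) (auto intro: inj_onI)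

lemma cnt_reflect: "X \<subseteq> {0..<1/2} \<Longrightarrow> cnt ((\<lambda>x. 1 - x) ` X) n = cnt X (n - 1)"
  unfolding cnt_def slice_reflect by (rule card_image) (auto intro: inj_onI)

lemma cnt_singleton:
  "cnt {x} n = (if x \<in> \<rat> \<and> mr_sum x \<le> n then 1 else 0)"
proof -
  have "slice {x} n = (if x \<in> \<rat> \<and> mr_sum x \<le> n then {x} else {})"
    by (auto simp: slice_def)
  then show ?thesis by (simp add: cnt_def)
qed

lemma cnt_atLeast_shift: "cnt {x + of_int k..} n = cnt {x..} (n - k)"
proof -
  have "z \<in> (\<lambda>x. x + real_of_int k) ` {x..}" if "z \<in> {x + real_of_int k..}" for z
    using that by (intro image_eqI[of _ _ "z - real_of_int k"]) auto
  then have "(\<lambda>x. x + real_of_int k) ` {x..} = {x + real_of_int k..}" by auto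
  then show ?thesis using cnt_shift[of k "{x..}" n] by metis
qed

text \<open>The points from \<open>k + y\<close> on are those of \<open>[k + y, k + 1)\<close> and a translate of \<open>[2, \<infinity>)\<close>.\<close>
lemma cnt_greaterThanAtMost:
  assumes "0 < x" "x \<le> 1/2" "inverse x = of_int k + y" "0 \<le> y" "y < 1"
  shows "cnt {0<..x} n = cnt {y..<1} (n - k) + cnt {2..} (n - k + 1)"
proof -
  have ix: "2 \<le> inverse x" using assms(1,2) by (simp add: field_simps)
  have "inverse ` {inverse x..} = {0<..x}"
  proof -
    have "z \<in> inverse ` {inverse x..}" if "z \<in> {0<..x}" for z
      using that assms(1) by (intro image_eqI[of _ _ "inverse z"]) auto
    moreover have "inverse z \<in> {0<..x}" if "z \<ge> inverse x" for z
      using that assms(1) ix le_imp_inverse_le[of "inverse x" z] by auto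
    ultimately show ?thesis by auto
  qed
  then have "cnt {0<..x} n = cnt {inverse x..} n"
    using cnt_inverse[of "{inverse x..}" n] ix by simp
  also have "\<dots> = cnt {y + of_int k..<1 + of_int k} n + cnt {2 + of_int (k - 1)..} n"
    using assms(3,5) ix by (intro cnt_Un) auto
  also have "\<dots> = cnt {y..<1} (n - k) + cnt {2..} (n - k + 1)"
    using cnt_shift[of k "{y..<1}" n] unfolding cnt_atLeast_shift
    by (simp add: algebra_simps)
  finally show ?thesis .
qed

lemma image_one_minus: "(\<lambda>x. 1 - x) ` {a..<b} = {1 - b<..1 - a::real}"
proof -
  have "x \<in> (\<lambda>x. 1 - x) ` {a..<b}" if "x \<in> {1 - b<..1 - a}" for x
    using that by (intro image_eqI[of _ _ "1 - x"]) auto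
  then show ?thesis by auto
qed

text \<open>The reflection of [0, x) is (1 - x, 1]. The half-open interval keeps 1/2 itself from
  being reflected when \<open>x = 1/2\<close>.\<close>

lemma cnt_upper:
  assumes "0 \<le> x" "x \<le> 1/2"
  shows "cnt {0..1} n = cnt {0..1 - x} n + cnt {0..<x} (n - 1)"
proof -
  have "cnt {0..1} n = cnt {0..1 - x} n + cnt ((\<lambda>x. 1 - x) ` {0..<x}) n"
    unfolding image_one_minus by (rule cnt_Un) (use assms in auto)
  moreover have "cnt ((\<lambda>x. 1 - x) ` {0..<x}) n = cnt {0..<x} (n - 1)"
    using assms by (intro cnt_reflect) auto
  ultimately show ?thesis by simp
qed

lemma cnt_closed:
  assumes "0 \<le> x"
  shows "cnt {0..x} n = cnt {0..<x} n + cnt {x} n"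
  by (rule cnt_Un) (use assms in auto)

lemma cnt_zero_closed:
  assumes "0 \<le> x"
  shows "cnt {0..x} n = cnt {0<..x} n + cnt {0} n"
  by (rule cnt_Un) (use assms in auto)

section \<open>The Tribonacci recurrence on [2, \<infinity>)\<close>

lemma mr_sum_half: "mr_sum (1/2) = 2"
  using mr_sum_inverse[of 2] mr_sum_of_int[of 2] by (simp add: inverse_eq_divide)

text \<open>Cut [0, 1] at 1/2: the lower part is 0 and the inverses of [2, \<infinity>), the upper
  part a reflection one level down. The corrections for 0, 1/2 and 1 cancel once 1/2, of digit sum
  2, is counted at level \<open>n - 1\<close>.\<close>

lemma cnt_unit_eq:
  assumes "n \<ge> 3"
  shows "cnt {0..<1} n = cnt {2..} n + cnt {2..} (n - 1)"
proof -
  have half: "cnt {0..1/2} m = cnt {2..} m + 1" if "m \<ge> 0" for m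
    using cnt_zero_closed[of "1/2" m] cnt_inverse[of "{2..}" m] that mr_sum_of_int[of 0]
    by (simp add: inverse_image_atLeast_two cnt_singleton)
  have "cnt {0..1} n = cnt {0..<1} n + 1"
    using cnt_closed[of 1 n] mr_sum_of_int[of 1] assms by (simp add: cnt_singleton)
  moreover have "cnt {0..1/2} (n - 1) = cnt {0..<1/2} (n - 1) + 1"
    using cnt_closed[of "1/2" "n - 1"] assms by (simp add: cnt_singleton mr_sum_half)
  ultimately show ?thesis
    using cnt_upper[of "1/2" n] half[of n] half[of "n - 1"] assms by simp
qed

text \<open>[2, 3) is a translate of [0, 1), which contributes levels \<open>n - 2\<close> and
  \<open>n - 3\<close>; [3, \<infinity>) is a translate of [2, \<infinity>).\<close>

lemma cnt_atLeast_two_rec: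
  assumes "n \<ge> 5"
  shows "cnt {2..} n = cnt {2..} (n - 1) + cnt {2..} (n - 2) + cnt {2..} (n - 3)"
proof -
  have "cnt {2..} n = cnt {2..<3} n + cnt {3..} n"
    by (rule cnt_Un) auto
  then show ?thesis
    using cnt_unit_eq[of "n - 2"] cnt_shift[of 2 "{0..<1}" n] cnt_atLeast_shift[of 2 1 n] assms
    by simp
qed

lemma cnt_atLeast_two_pos:
  assumes "n \<ge> 2"
  shows "cnt {2..} n > 0"
proof -
  have "cnt {2} n \<le> cnt {2..} n" by (rule cnt_mono) auto
  then show ?thesis using assms mr_sum_of_int[of 2] by (simp add: cnt_singleton)
qed

section \<open>Convergence of weighted-mean recurrences\<close>

lemma tendsto_weighted_mean_rec:
  fixes w :: "nat \<Rightarrow> real"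
  assumes pqs: "p + q + s = 1" "0 < q" "0 < s" "s < p"
    and pos: "w 0 > 0" "w 1 > 0" "w 2 > 0"
    and rec: "\<And>n. w (n + 3) = p * w (n + 2) + q * w (n + 1) + s * w n"
  obtains K where "K > 0" "w \<longlonglongrightarrow> K"
proof -
  \<comment> \<open>\<open>J\<close> is conserved by the recurrence; subtracting its fixed point leaves a contracting
    recurrence of order two.\<close>
  define J where "J = w 2 + (q + s) * w 1 + s * w 0"
  have p: "p = 1 - q - s" using pqs by simp
  have inv: "w (n + 2) + (q + s) * w (n + 1) + s * w n = J" for n
  proof (induction n)
    case (Suc n)
    then show ?case using rec[of n] unfolding p by (simp add: algebra_simps eval_nat_numeral)
  qed (simp add: J_def eval_nat_numeral)
  \<comment> \<open>The absolute coefficients \<open>q + s\<close> and \<open>s\<close> of the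
    reduced recurrence add up to \<open>c\<close>; \<open>s < p\<close> gives
    \<open>c < 1\<close>.\<close>
  define c where "c = q + 2 * s"
  define K where "K = J / (1 + c)"
  have c: "0 < c" "c < 1" using pqs by (simp_all add: c_def)
  have "J > 0" unfolding J_def using pos pqs by (intro add_pos_pos mult_pos_pos) auto
  then have "K > 0" using c by (simp add: K_def)
  define d where "d n = w n - K" for n
  have JK: "J = K * (1 + q + 2 * s)" using c by (simp add: K_def c_def add.assoc)
  have d: "d (n + 2) = - ((q + s) * d (n + 1) + s * d n)" for n
    using inv[of n] unfolding d_def JK by (simp add: algebra_simps)
  \<comment> \<open>A factor \<open>c\<close> is gained every two steps, hence \<open>sqrt c\<close>
    per step.\<close>
  define r where "r = sqrt c"
  have r: "0 < r" "r < 1" "r * r = c" using c by (simp_all add: r_def)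
  define C where "C = max \<bar>d 0\<bar> (\<bar>d 1\<bar> / r)"
  have C: "\<bar>d 0\<bar> \<le> C" "\<bar>d 1\<bar> \<le> C * r" "0 \<le> C"
    using r by (auto simp: C_def pos_divide_le_eq[symmetric])
  have bound: "\<bar>d n\<bar> \<le> C * r ^ n \<and> \<bar>d (Suc n)\<bar> \<le> C * r ^ Suc n" for n
  proof (induction n)
    case (Suc n)
    have "\<bar>d (n + 2)\<bar> \<le> (q + s) * \<bar>d (n + 1)\<bar> + s * \<bar>d n\<bar>"
      unfolding d abs_minus_cancel
      by (rule order_trans[OF abs_triangle_ineq]) (use pqs in \<open>simp add: abs_mult\<close>)
    also have "\<dots> \<le> (q + s) * (C * r ^ n) + s * (C * r ^ n)"
    proof (intro add_mono mult_left_mono)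
      have "C * r ^ Suc n \<le> C * r ^ n"
        using r C(3) by (intro mult_left_mono power_decreasing) auto
      then show "\<bar>d (n + 1)\<bar> \<le> C * r ^ n" using Suc by simp
    qed (use Suc pqs in auto)
    also have "\<dots> = C * r ^ n * c" by (simp add: c_def algebra_simps)
    also have "\<dots> = C * r ^ (n + 2)" by (simp add: r(3)[symmetric])
    finally show ?case using Suc by simp
  qed (use C in auto)
  have "(\<lambda>n. C * r ^ n) \<longlonglongrightarrow> 0"
    using r by (intro tendsto_mult_right_zero LIMSEQ_realpow_zero) auto
  then have "d \<longlonglongrightarrow> 0"
    by (rule tendsto_0_le[of _ _ _ 1])
      (use bound r C(3) in \<open>auto simp: abs_mult\<close>)
  then have "w \<longlonglongrightarrow> K" unfolding d_def by (simp add: LIM_zero_iff)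
  then show thesis using that \<open>K > 0\<close> by blast
qed

section \<open>Limits along the integers and asymptotic oscillation\<close>

lemma filterlim_int_minus_const: "filterlim (\<lambda>n::int. n - k) at_top at_top"
  unfolding filterlim_at_top eventually_at_top_linorder
proof
  fix Z show "\<exists>N. \<forall>n\<ge>N. Z \<le> n - k" by (intro exI[of _ "Z + k"]) auto
qed

lemma tendsto_minus_const:
  "(h \<longlongrightarrow> L) at_top \<Longrightarrow> ((\<lambda>n::int. h (n - k)) \<longlongrightarrow> L) at_top"
  by (rule filterlim_compose[OF _ filterlim_int_minus_const])

lemma tendsto_at_top_int_iff:
  fixes h :: "int \<Rightarrow> 'a::topological_space"
  shows "(h \<longlongrightarrow> L) at_top \<longleftrightarrow> (\<lambda>n. h (int n)) \<longlonglongrightarrow> L"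
proof
  assume "(\<lambda>n. h (int n)) \<longlonglongrightarrow> L"
  then have "((\<lambda>n. h (int (nat n))) \<longlongrightarrow> L) at_top"
    by (rule filterlim_compose[OF _ filterlim_nat_sequentially])
  then show "(h \<longlongrightarrow> L) at_top"
    by (rule Lim_transform_eventually) (use eventually_ge_at_top[of 0] in eventually_elim, simp)
next
  assume "(h \<longlongrightarrow> L) at_top"
  then show "(\<lambda>n. h (int n)) \<longlonglongrightarrow> L"
    by (rule filterlim_compose) (rule filterlim_int_sequentially)
qed

text \<open>For bounded \<open>h\<close> this says that limsup minus liminf is at most
  \<open>2 * c\<close>; the centre \<open>L\<close> need not be a limit.\<close>

definition osc_le :: "real \<Rightarrow> (int \<Rightarrow> real) \<Rightarrow> bool" where
  "osc_le c h \<longleftrightarrow> (\<exists>L. \<forall>\<epsilon>>0. \<forall>\<^sub>F n in at_top. \<bar>h n - L\<bar> < c + \<epsilon>)"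

lemma osc_le_mono:
  assumes "osc_le c h" "c \<le> c'"
  shows "osc_le c' h"
proof -
  obtain L where L: "\<And>\<epsilon>. \<epsilon> > 0 \<Longrightarrow> \<forall>\<^sub>F n in at_top. \<bar>h n - L\<bar> < c + \<epsilon>"
    using assms(1) by (auto simp: osc_le_def)
  have "\<forall>\<^sub>F n in at_top. \<bar>h n - L\<bar> < c' + \<epsilon>" if "\<epsilon> > 0" for \<epsilon>
    using L[OF that] by eventually_elim (use assms(2) in simp)
  then show ?thesis by (auto simp: osc_le_def)
qed

lemma osc_le_of_tendsto:
  assumes "(h \<longlongrightarrow> L) at_top" "0 \<le> c"
  shows "osc_le c h"
proof -
  have "osc_le 0 h"
    using tendstoD[OF assms(1)] by (auto simp: osc_le_def dist_real_def)
  then show ?thesis by (rule osc_le_mono) (rule assms(2))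
qed

text \<open>A convergent summand only moves the centre, and an index shift is invisible at
  infinity.\<close>

lemma osc_le_affine:
  assumes "osc_le c h" "(g \<longlongrightarrow> G) at_top"
  shows "osc_le (\<bar>\<alpha>\<bar> * c) (\<lambda>n. g n + \<alpha> * h (n - k))"
proof -
  obtain L where L: "\<And>\<epsilon>. \<epsilon> > 0 \<Longrightarrow> \<forall>\<^sub>F n in at_top. \<bar>h n - L\<bar> < c + \<epsilon>"
    using assms(1) by (auto simp: osc_le_def)
  have "\<forall>\<^sub>F n in at_top. \<bar>g n + \<alpha> * h (n - k) - (G + \<alpha> * L)\<bar> < \<bar>\<alpha>\<bar> * c + \<epsilon>" if "\<epsilon> > 0" for \<epsilon>
  proof -
    \<comment> \<open>The added 1 guards against \<open>\<alpha> = 0\<close>.\<close>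
    define \<delta> where "\<delta> = \<epsilon> / (2 * (\<bar>\<alpha>\<bar> + 1))"
    have \<delta>: "\<delta> > 0" "\<bar>\<alpha>\<bar> * \<delta> \<le> \<epsilon> / 2" using that by (auto simp: \<delta>_def field_simps)
    have "\<forall>\<^sub>F n in at_top. \<bar>h (n - k) - L\<bar> < c + \<delta>"
      using L[OF \<delta>(1)] filterlim_int_minus_const by (rule eventually_compose_filterlim)
    moreover have "\<forall>\<^sub>F n in at_top. \<bar>g n - G\<bar> < \<epsilon> / 2"
      using tendstoD[OF assms(2), of "\<epsilon> / 2"] that by (simp add: dist_real_def)
    ultimately show ?thesis
    proof eventually_elim
      case (elim n)
      have "\<bar>g n + \<alpha> * h (n - k) - (G + \<alpha> * L)\<bar> \<le> \<bar>g n - G\<bar> + \<bar>\<alpha>\<bar> * \<bar>h (n - k) - L\<bar>"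
        unfolding abs_mult[symmetric] by (simp add: algebra_simps)
      also have "\<dots> < \<epsilon> / 2 + \<bar>\<alpha>\<bar> * (c + \<delta>)"
        using elim by (intro add_less_le_mono mult_left_mono) auto
      finally show ?case using \<delta>(2) by (simp add: algebra_simps)
    qed
  qed
  then show ?thesis unfolding osc_le_def by blast
qed

text \<open>The centres may vary with \<open>c\<close>; the Cauchy criterion avoids comparing
  them.\<close>

lemma osc_le_imp_convergent:
  assumes "\<And>c. c > 0 \<Longrightarrow> osc_le c h"
  shows "\<exists>L. (h \<longlongrightarrow> L) at_top"
proof -
  have "Cauchy (\<lambda>n. h (int n))"
  proof (rule metric_CauchyI)
    fix e :: real assume "e > 0"
    with assms[of "e / 4"] obtain L where "\<And>\<epsilon>. \<epsilon> > 0 \<Longrightarrow> \<forall>\<^sub>F n in at_top. \<bar>h n - L\<bar> < e / 4 + \<epsilon>"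
      by (auto simp: osc_le_def)
    from this[of "e / 4"] \<open>e > 0\<close> have "\<forall>\<^sub>F n in at_top. \<bar>h n - L\<bar> < e / 2" by simp
    then have "\<forall>\<^sub>F n in sequentially. \<bar>h (int n) - L\<bar> < e / 2"
      by (rule eventually_compose_filterlim) (rule filterlim_int_sequentially)
    then obtain M where M: "\<And>n. n \<ge> M \<Longrightarrow> \<bar>h (int n) - L\<bar> < e / 2"
      by (auto simp: eventually_sequentially)
    have "dist (h (int m)) (h (int n)) < e" if "m \<ge> M" "n \<ge> M" for m n
      using M[OF that(1)] M[OF that(2)] unfolding dist_real_def by linarith
    then show "\<exists>M. \<forall>m\<ge>M. \<forall>n\<ge>M. dist (h (int m)) (h (int n)) < e" by blast
  qed
  then show ?thesis
    unfolding tendsto_at_top_int_iff by (simp add: Cauchy_convergent_iff convergent_def)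
qed

section \<open>Counts normalised by powers of the cubic root\<close>

context
  fixes lam :: real
  assumes root: "lam ^ 3 - lam ^ 2 - lam - 1 = 0"
begin

lemma lam_gt_1: "lam > 1"
proof (rule ccontr)
  assume l: "\<not> lam > 1"
  have eq: "(lam - 1)^2 * (lam + 1) = 2"
    using root by (simp add: power2_eq_square power3_eq_cube algebra_simps)
  have "(lam - 1)^2 * (lam + 1) = (1 - lam) - lam\<^sup>2 * (1 - lam)"
    by (simp add: power2_eq_square algebra_simps)
  moreover have "lam\<^sup>2 * (1 - lam) \<ge> 0" using l by (intro mult_nonneg_nonneg) auto
  moreover have "lam + 1 > 0"
    using eq by (smt (verit) mult_nonneg_nonpos zero_le_power2)
  ultimately show False using eq by linarith
qed

definition ncnt :: "real set \<Rightarrow> int \<Rightarrow> real" where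
  "ncnt X n = real (cnt X n) / lam powi n"

text \<open>Translates counting identities into normalised ones; the contraction factors
  \<open>lam powi - k\<close> originate here.\<close>

lemma ncnt_minus: "real (cnt X (n - k)) / lam powi n = lam powi - k * ncnt X (n - k)"
  using lam_gt_1 by (simp add: ncnt_def power_int_diff power_int_minus field_simps)

lemma tendsto_power_int_zero: "((\<lambda>n. 1 / lam powi n) \<longlongrightarrow> 0) at_top"
proof -
  have "(\<lambda>n. (1 / lam) ^ n) \<longlonglongrightarrow> 0"
    using lam_gt_1 by (intro LIMSEQ_realpow_zero) auto
  then show ?thesis by (simp add: tendsto_at_top_int_iff power_one_over)
qed

lemma ncnt_singleton_tendsto: "(ncnt {x} \<longlongrightarrow> 0) at_top"
  by (rule tendsto_0_le[OF tendsto_power_int_zero, of _ 1])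
     (use lam_gt_1 in \<open>auto simp: ncnt_def cnt_singleton\<close>)

text \<open>Dividing the cubic by \<open>lam^3\<close> shows that the normalised Tribonacci
  recurrence has weights of sum 1.\<close>

lemma ncnt_atLeast_two_tendsto:
  obtains K where "K > 0" "(ncnt {2..} \<longlongrightarrow> K) at_top"
proof -
  \<comment> \<open>From level 2 on the counts are positive, and \<open>w (n + 3)\<close> has level
    at least 5, where the recurrence holds.\<close>
  define w where "w n = ncnt {2..} (int n + 2)" for n
  have l: "lam > 0" using lam_gt_1 by simp
  obtain K where "K > 0" "w \<longlonglongrightarrow> K"
  proof (rule tendsto_weighted_mean_rec)
    have "1 / lam + 1 / lam^2 + 1 / lam^3 = (lam^2 + lam + 1) / lam^3"
      using l by (simp add: add_divide_distrib power2_eq_square power3_eq_cube)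
    also have "lam^2 + lam + 1 = lam^3" using root by simp
    finally show "1 / lam + 1 / lam^2 + 1 / lam^3 = 1" using l by simp
    show "1 / lam^3 < 1 / lam"
      using lam_gt_1 power_strict_increasing[of 1 3 lam] by (simp add: field_simps)
    show "w 0 > 0" "w 1 > 0" "w 2 > 0"
      using l cnt_atLeast_two_pos by (simp_all add: w_def ncnt_def)
    show "w (n + 3) = 1 / lam * w (n + 2) + 1 / lam^2 * w (n + 1) + 1 / lam^3 * w n" for n
    proof -
      have "w (n + 3) = real (cnt {2..} (int n + 5 - 1)) / lam powi (int n + 5)
          + real (cnt {2..} (int n + 5 - 2)) / lam powi (int n + 5)
          + real (cnt {2..} (int n + 5 - 3)) / lam powi (int n + 5)"
        using cnt_atLeast_two_rec[of "int n + 5"]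
        by (simp add: w_def ncnt_def add_divide_distrib add.commute)
      then show ?thesis unfolding ncnt_minus
        by (simp add: w_def power_int_minus divide_inverse algebra_simps)
    qed
  qed (use l in auto)
  have "(\<lambda>n. w (n - 2)) \<longlonglongrightarrow> K"
    using \<open>w \<longlonglongrightarrow> K\<close> LIMSEQ_offset[of "\<lambda>n. w (n - 2)" 2] by simp
  moreover have "\<forall>\<^sub>F n in sequentially. w (n - 2) = ncnt {2..} (int n)"
    using eventually_ge_at_top[of 2] by eventually_elim (simp add: w_def of_nat_diff)
  ultimately have "(ncnt {2..} \<longlongrightarrow> K) at_top"
    unfolding tendsto_at_top_int_iff by (rule Lim_transform_eventually)
  then show thesis using that \<open>K > 0\<close> by blast
qed

lemma ncnt_unit_tendsto:
  obtains K where "K > 0" "(ncnt {0..<1} \<longlongrightarrow> K) at_top" "(ncnt {0..1} \<longlongrightarrow> K) at_top"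
proof -
  obtain K where K: "K > 0" "(ncnt {2..} \<longlongrightarrow> K) at_top"
    using ncnt_atLeast_two_tendsto .
  define M where "M = K + lam powi - 1 * K"
  have "M > 0" unfolding M_def using K(1) lam_gt_1 by (intro add_pos_pos mult_pos_pos) auto
  have "((\<lambda>n. ncnt {2..} n + lam powi - 1 * ncnt {2..} (n - 1)) \<longlongrightarrow> M) at_top"
    unfolding M_def by (intro tendsto_intros K tendsto_minus_const)
  moreover have "\<forall>\<^sub>F n in at_top. ncnt {2..} n + lam powi - 1 * ncnt {2..} (n - 1) = ncnt {0..<1} n"
    using eventually_ge_at_top[of 3]
    by eventually_elim
      (simp only: ncnt_minus[symmetric], simp add: ncnt_def cnt_unit_eq add_divide_distrib)
  ultimately have M: "(ncnt {0..<1} \<longlongrightarrow> M) at_top" by (rule Lim_transform_eventually)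
  have "((\<lambda>n. ncnt {0..<1} n + ncnt {1} n) \<longlongrightarrow> M + 0) at_top"
    by (intro tendsto_add M ncnt_singleton_tendsto)
  then have "(ncnt {0..1} \<longlongrightarrow> M) at_top"
    by (simp add: ncnt_def[abs_def] cnt_closed[of 1] add_divide_distrib)
  then show thesis using that M \<open>M > 0\<close> by blast
qed

text \<open>Grouped in the shape of \<open>osc_le_affine\<close>: a convergent bracket plus a
  multiple of one shifted sequence. The term for \<open>{x}\<close> closes [0, x).\<close>

lemma ncnt_upper:
  assumes "0 \<le> x" "x \<le> 1/2"
  shows "ncnt {0..1 - x} n =
    (ncnt {0..1} n + lam powi - 1 * ncnt {x} (n - 1)) + - (lam powi - 1) * ncnt {0..x} (n - 1)"
  using cnt_upper[OF assms, of n] cnt_closed[OF assms(1), of "n - 1"]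
  unfolding minus_mult_left[symmetric] ncnt_minus[symmetric]
  by (simp add: ncnt_def add_divide_distrib)

text \<open>Same shape: the piece [y, 1) left by inversion is [0, 1) without [0, y), whence the
  negative coefficient.\<close>

lemma ncnt_lower:
  assumes "0 < x" "x \<le> 1/2" "inverse x = of_int k + y" "0 \<le> y" "y < 1"
  shows "ncnt {0..x} n =
    (ncnt {0} n + lam powi - k * ncnt {0..<1} (n - k) + lam powi - k * ncnt {y} (n - k)
      + lam powi - (k - 1) * ncnt {2..} (n - (k - 1)))
    + - (lam powi - k) * ncnt {0..y} (n - k)"
proof -
  have "cnt {0..<1} (n - k) = cnt {0..<y} (n - k) + cnt {y..<1} (n - k)"
    by (rule cnt_Un) (use assms in auto)
  then show ?thesis
    using cnt_greaterThanAtMost[OF assms, of n] cnt_zero_closed[of x n] cnt_closed[of y "n - k"] assms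
    unfolding minus_mult_left[symmetric] ncnt_minus[symmetric]
    by (simp add: ncnt_def add_divide_distrib algebra_simps)
qed

text \<open>Below 1/2 inversion gives the factor \<open>lam powi - k\<close> with
  \<open>k \<ge> 2\<close>; above 1/2 reflection gives exactly \<open>1 / lam\<close>. All other
  terms converge.\<close>

lemma osc_le_contract:
  assumes c: "0 \<le> c" and osc: "\<And>x. x \<in> {0..1} \<Longrightarrow> osc_le c (ncnt {0..x})"
    and x: "x \<in> {0..1}"
  shows "osc_le (c / lam) (ncnt {0..x})"
proof -
  have cl: "0 \<le> c / lam" using c lam_gt_1 by simp
  obtain K where K: "(ncnt {2..} \<longlongrightarrow> K) at_top" using ncnt_atLeast_two_tendsto .
  obtain M where M: "(ncnt {0..<1} \<longlongrightarrow> M) at_top" "(ncnt {0..1} \<longlongrightarrow> M) at_top"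
    using ncnt_unit_tendsto .
  consider "x = 0" | "0 < x" "x \<le> 1/2" | "x > 1/2" using x by fastforce
  then show ?thesis
  proof cases
    case 1
    then show ?thesis using osc_le_of_tendsto[OF ncnt_singleton_tendsto cl] by simp
  next
    case 2
    define k where "k = \<lfloor>inverse x\<rfloor>"
    define y where "y = frac (inverse x)"
    have y: "inverse x = of_int k + y" "0 \<le> y" "y < 1"
      by (simp_all add: k_def y_def frac_def) linarith
    have "2 \<le> inverse x" using 2 by (simp add: field_simps)
    then have k: "k \<ge> 2" by (simp add: k_def le_floor_iff)
    note G = tendsto_add[OF tendsto_add[OF tendsto_add[OF ncnt_singleton_tendsto[of 0]
          tendsto_mult_left[OF tendsto_minus_const[OF M(1)]]]
          tendsto_mult_left[OF tendsto_minus_const[OF ncnt_singleton_tendsto[of y]]]]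
          tendsto_mult_left[OF tendsto_minus_const[OF K]]]
    have "osc_le (\<bar>- (lam powi - k)\<bar> * c) (ncnt {0..x})"
      unfolding ncnt_lower[OF 2 y, abs_def]
      by (rule osc_le_affine[OF osc G]) (use y in simp)
    moreover have "\<bar>- (lam powi - k)\<bar> \<le> inverse lam"
      using power_int_increasing[of "- k" "-1" lam] k lam_gt_1 by (simp add: power_int_minus)
    from mult_right_mono[OF this c] have "\<bar>- (lam powi - k)\<bar> * c \<le> c / lam"
      by (simp add: divide_inverse mult.commute)
    ultimately show ?thesis by (rule osc_le_mono)
  next
    case 3
    have z: "0 \<le> 1 - x" "1 - x \<le> 1/2" using 3 x by auto
    note G = tendsto_add[OF M(2)
        tendsto_mult_left[OF tendsto_minus_const[OF ncnt_singleton_tendsto[of "1 - x"]]]]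
    \<comment> \<open>The form \<open>1 - (1 - x)\<close> lets \<open>ncnt_upper\<close> apply at
      the reflected point.\<close>
    have "osc_le (\<bar>- (lam powi - 1)\<bar> * c) (ncnt {0..1 - (1 - x)})"
      unfolding ncnt_upper[OF z, abs_def]
      by (rule osc_le_affine[OF osc G]) (use z in simp)
    then show ?thesis using lam_gt_1 by (simp add: power_int_minus divide_inverse mult.commute)
  qed
qed

lemma ncnt_convergent:
  assumes "x \<in> {0..1}"
  shows "\<exists>L. (ncnt {0..x} \<longlongrightarrow> L) at_top"
proof -
  obtain M where M: "M > 0" "(ncnt {0..1} \<longlongrightarrow> M) at_top"
    using ncnt_unit_tendsto .
  \<comment> \<open>By monotonicity, the limit \<open>M\<close> on [0, 1] bounds all
    \<open>x\<close> at once, with centre 0.\<close>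
  have base: "osc_le M (ncnt {0..x})" if "x \<in> {0..1}" for x
    unfolding osc_le_def
  proof (intro exI[of _ 0] allI impI)
    fix \<epsilon> :: real assume "\<epsilon> > 0"
    then have "\<forall>\<^sub>F n in at_top. ncnt {0..1} n < M + \<epsilon>"
      using order_tendstoD(2)[OF M(2)] by simp
    then show "\<forall>\<^sub>F n in at_top. \<bar>ncnt {0..x} n - 0\<bar> < M + \<epsilon>"
    proof eventually_elim
      case (elim n)
      have "cnt {0..x} n \<le> cnt {0..1} n" using that by (intro cnt_mono) auto
      then have "ncnt {0..x} n \<le> ncnt {0..1} n"
        unfolding ncnt_def using lam_gt_1 by (intro divide_right_mono) auto
      moreover have "ncnt {0..x} n \<ge> 0" unfolding ncnt_def using lam_gt_1 by simp
      ultimately show ?case using elim by simp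
    qed
  qed
  \<comment> \<open>All \<open>x\<close> are treated together because each contraction moves to
    another point.\<close>
  have iter: "\<forall>x\<in>{0..1}. osc_le (M / lam ^ j) (ncnt {0..x})" for j
  proof (induction j)
    case (Suc j)
    have "osc_le (M / lam ^ j / lam) (ncnt {0..x})" if "x \<in> {0..1}" for x
      by (rule osc_le_contract) (use that Suc M(1) lam_gt_1 in auto)
    then show ?case by (simp add: power_Suc2 del: power_Suc)
  qed (use base in simp)
  show ?thesis
  proof (rule osc_le_imp_convergent)
    fix c :: real assume "c > 0"
    obtain j where "M / c < lam ^ j"
      using real_arch_pow[OF lam_gt_1] by blast
    then have "M / lam ^ j \<le> c"
      using \<open>c > 0\<close> lam_gt_1 by (simp add: field_simps)
    then show "osc_le c (ncnt {0..x})" using iter assms osc_le_mono by blast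
  qed
qed

section \<open>The limit distribution function\<close>

lemma mr_F_eq:
  assumes "x \<in> {0..1}" "(ncnt {0..x} \<longlongrightarrow> L) at_top" "(ncnt {0..1} \<longlongrightarrow> M) at_top" "M > 0"
  shows "mr_F x = L / M"
proof -
  \<comment> \<open>\<open>mr_Z n\<close> has level \<open>n + 1\<close>; the common power of
    \<open>lam\<close> cancels in the quotient.\<close>
  have lim: "(\<lambda>n. ncnt {0..y} (int n + 1)) \<longlonglongrightarrow> l" if "(ncnt {0..y} \<longlongrightarrow> l) at_top" for y l
    using tendsto_minus_const[OF that, of "-1"] by (simp add: tendsto_at_top_int_iff)
  have Z: "mr_Z n = slice {0..1} (int n + 1)" for n
    by (simp add: mr_Z_def slice_def)
  have Zx: "{\<xi> \<in> mr_Z n. \<xi> \<le> x} = slice {0..x} (int n + 1)" for n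
    using assms(1) by (auto simp: mr_Z_def slice_def)
  have "(\<lambda>n. ncnt {0..x} (int n + 1) / ncnt {0..1} (int n + 1)) \<longlonglongrightarrow> L / M"
    using assms by (intro tendsto_divide lim) auto
  moreover have "ncnt {0..x} (int n + 1) / ncnt {0..1} (int n + 1) =
      real (card {\<xi> \<in> mr_Z n. \<xi> \<le> x}) / real (card (mr_Z n))" for n
    unfolding Zx unfolding Z using lam_gt_1 by (simp add: ncnt_def cnt_def)
  ultimately show ?thesis unfolding mr_F_def by (simp add: limI)
qed

text \<open>In the limit of \<open>ncnt_upper\<close> the point \<open>{x}\<close> vanishes and the
  drop by one level becomes the factor \<open>1 / lam\<close>.\<close>

lemma mr_F_reflect:
  assumes "x \<in> {0..1/2}"
  shows "mr_F (1 - x) = 1 - mr_F x / lam"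
proof -
  obtain M where M: "M > 0" "(ncnt {0..1} \<longlongrightarrow> M) at_top"
    using ncnt_unit_tendsto .
  obtain L where L: "(ncnt {0..x} \<longlongrightarrow> L) at_top"
    using ncnt_convergent[of x] assms by auto
  have x: "0 \<le> x" "x \<le> 1/2" "x \<in> {0..1}" "1 - x \<in> {0..1}" using assms by auto
  have "(ncnt {0..1 - x} \<longlongrightarrow> M + lam powi - 1 * 0 + - (lam powi - 1) * L) at_top"
    unfolding ncnt_upper[OF x(1,2), abs_def]
    by (rule tendsto_add[OF tendsto_add[OF M(2)
          tendsto_mult_left[OF tendsto_minus_const[OF ncnt_singleton_tendsto[of x]]]]
          tendsto_mult_left[OF tendsto_minus_const[OF L]]])
  from mr_F_eq[OF x(4) this M(2,1)] have "mr_F (1 - x) = (M - L / lam) / M"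
    by (simp add: power_int_minus divide_inverse)
  also have "\<dots> = 1 - L / M / lam"
    using M(1) by (simp add: diff_divide_distrib)
  also have "L / M = mr_F x"
    using mr_F_eq[OF x(3) L M(2,1)] by simp
  finally show ?thesis .
qed

end

theorem proposition1:
  fixes lam x :: real
  assumes "lam ^ 3 - lam ^ 2 - lam - 1 = 0"
    and "x \<in> {0..1/2}"
  shows "mr_F (1 - x) = 1 - mr_F x / lam"
  using mr_F_reflect[OF assms] .

end
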